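(* Let $X$ be a Kaplansky-Hilbert module over $L^0$ and let $\mathcal{D}\subset X$ be a $bo$-dense submodule containing a vector $e$ with $\|e\|=\mathbf{1}$. Let $\mathcal{U}$ be an algebra over $L^0$ with $\mathcal{F}^+(\mathcal{D})\subset\mathcal{U}\subset\mathcal{L}^+(\mathcal{D})$ and let $\delta:\mathcal{U}\to\mathcal{L}^+(\mathcal{D})$ be an $L^0$-linear derivation. Then there exists $x\in\mathcal{L}^+(\mathcal{D})$ such that $\delta(a)=xa-ax$ for all $a\in\mathcal{U}$. In particular, each $L^0$-linear derivation of the algebra $\mathcal{L}^+(\mathcal{D})$ is inner, i.e. of the form $a\mapsto xa-ax$ with $x\in\mathcal{L}^+(\mathcal{D})$.
   Context: $(\Omega,\Sigma,\mu)$ is a space with a complete finite measure; $L^0=L^0(\Omega)$ is the algebra of all complex measurable functions on it modulo a.e. equality, with unit $\mathbf{1}$. A Kaplansky-Hilbert module over $L^0$ is an $L^0$-module $X$ with an $L^0$-valued inner product $\langle\cdot,\cdot\rangle$ ($\langle\varphi,\varphi\rangle\ge 0$; $\langle\varphi,\varphi\rangle=0$ iff $\varphi=0$; $\langle\varphi,\psi\rangle=\overline{\langle\psi,\varphi\rangle}$; $L^0$-linear in the first variable) such that, with the $L^0$-valued norm $\|\varphi\|=\sqrt{\langle\varphi,\varphi\rangle}$, $X$ is a Banach-Kantorovich space: it is $d$-decomposable (whenever $\|\varphi\|=e_1+e_2$ with $e_1,e_2\ge0$ disjoint in $L^0$, there are $\varphi_1,\varphi_2$ with $\varphi=\varphi_1+\varphi_2$,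 $\|\varphi_k\|=e_k$) and $(bo)$-complete. Here a net $\varphi_\alpha$ $(bo)$-converges to $\varphi$ if $\|\varphi_\alpha-\varphi\|$ $(o)$-converges (order convergence) to $0$ in $L^0$. A subset is $bo$-dense if every element of $X$ is a $bo$-limit of a net from the subset. The adjoint $a^*$ of an $L^0$-linear operator $a$ with $bo$-dense domain $\mathcal{D}$ has domain $\mathcal{D}(a^* )$ consisting of all $\psi\in X$ for which there is $\eta\in X$ with $\langle a\varphi,\psi\rangle=\langle\varphi,\eta\rangle$ for all $\varphi\in\mathcal{D}$, and $a^*\psi=\eta$. $\mathcal{L}^+(\mathcal{D})$ is the algebra of all $L^0$-linear operators $a$ with domain $\mathcal{D}$ such that $a\mathcal{D}\subset\mathcal{D}$, $\mathcal{D}\subset\mathcal{D}(a^* )$ and $a^*\mathcal{D}\subset\mathcal{D}$. $\mathcal{F}(\mathcal{D})$ is the set of all $L^0$-linear $a:\mathcal{D}\to\mathcal{D}$ whose image $a(\mathcal{D})$ is a finitely generated $L^0$-module, and $\mathcal{F}^+(\mathcal{D})=\mathcal{F}(\mathcal{D})\cap\mathcal{L}^+(\mathcal{D})$. A derivation is a linear map $\delta:\mathcal{U}\to\mathcal{L}^+(\mathcal{D})$ with $\delta(ab)=\delta(a)b+a\delta(b)$ for all $a,b\in\mathcal{U}$. *)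

theory Defs
  imports "HOL-Analysis.Analysis" "HOL-Algebra.Module"
begin

section \<open>The algebra of measurable functions modulo a.e. equality\<close>

definition L0_class :: "'w measure \<Rightarrow> ('w \<Rightarrow> complex) \<Rightarrow> ('w \<Rightarrow> complex) set"
  where "L0_class M f = {g \<in> borel_measurable M. AE w in M. g w = f w}"

definition L0_rep :: "('w \<Rightarrow> complex) set \<Rightarrow> 'w \<Rightarrow> complex"
  where "L0_rep A = (SOME f. f \<in> A)"

definition L0_map :: "'w measure \<Rightarrow> (complex \<Rightarrow> complex) \<Rightarrow>
    ('w \<Rightarrow> complex) set \<Rightarrow> ('w \<Rightarrow> complex) set"
  where "L0_map M h A = L0_class M (\<lambda>w. h (L0_rep A w))"

definition L0_map2 :: "'w measure \<Rightarrow> (complex \<Rightarrow> complex \<Rightarrow> complex) \<Rightarrow>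
    ('w \<Rightarrow> complex) set \<Rightarrow> ('w \<Rightarrow> complex) set \<Rightarrow> ('w \<Rightarrow> complex) set"
  where "L0_map2 M h A B = L0_class M (\<lambda>w. h (L0_rep A w) (L0_rep B w))"

definition L0 :: "'w measure \<Rightarrow> ('w \<Rightarrow> complex) set ring"
  where "L0 M =
    \<lparr>carrier = L0_class M ` borel_measurable M,
     mult = L0_map2 M (*),
     one = L0_class M (\<lambda>_. 1),
     zero = L0_class M (\<lambda>_. 0),
     add = L0_map2 M (+)\<rparr>"

lemma L0_class_eq_iff:
  assumes "f \<in> borel_measurable M" "g \<in> borel_measurable M"
  shows "L0_class M f = L0_class M g \<longleftrightarrow> (AE w in M. f w = g w)"
proof
  assume "L0_class M f = L0_class M g"
  then have "f \<in> L0_class M g" using assms by (auto simp: L0_class_def)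
  then show "AE w in M. f w = g w" by (simp add: L0_class_def)
next
  assume "AE w in M. f w = g w"
  then show "L0_class M f = L0_class M g"
    unfolding L0_class_def by (intro Collect_cong conj_cong refl) (auto elim: eventually_elim2)
qed

lemma L0_rep_class:
  assumes "f \<in> borel_measurable M"
  shows "L0_rep (L0_class M f) \<in> borel_measurable M"
    and "AE w in M. L0_rep (L0_class M f) w = f w"
proof -
  have "f \<in> L0_class M f" using assms by (simp add: L0_class_def)
  then have "L0_rep (L0_class M f) \<in> L0_class M f"
    unfolding L0_rep_def by (rule someI[where P = "\<lambda>g. g \<in> L0_class M f"])
  then show "L0_rep (L0_class M f) \<in> borel_measurable M"
    and "AE w in M. L0_rep (L0_class M f) w = f w" by (auto simp: L0_class_def)
qed

lemma L0_add_class: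
  assumes [measurable]: "f \<in> borel_measurable M" "g \<in> borel_measurable M"
  shows "L0_class M f \<oplus>\<^bsub>L0 M\<^esub> L0_class M g = L0_class M (\<lambda>w. f w + g w)"
proof -
  note [measurable] = L0_rep_class(1)
  show ?thesis
    using L0_rep_class(2)[OF assms(1)] L0_rep_class(2)[OF assms(2)]
    by (simp add: L0_def L0_map2_def) (subst L0_class_eq_iff, auto)
qed

lemma L0_mult_class:
  assumes [measurable]: "f \<in> borel_measurable M" "g \<in> borel_measurable M"
  shows "L0_class M f \<otimes>\<^bsub>L0 M\<^esub> L0_class M g = L0_class M (\<lambda>w. f w * g w)"
proof -
  note [measurable] = L0_rep_class(1)
  show ?thesis
    using L0_rep_class(2)[OF assms(1)] L0_rep_class(2)[OF assms(2)]
    by (simp add: L0_def L0_map2_def) (subst L0_class_eq_iff, auto)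
qed

lemma L0_carrierE:
  assumes "A \<in> carrier (L0 M)"
  obtains f where "f \<in> borel_measurable M" "A = L0_class M f"
  using assms by (auto simp: L0_def)

lemma L0_carrierI: "f \<in> borel_measurable M \<Longrightarrow> L0_class M f \<in> carrier (L0 M)"
  by (simp add: L0_def)

lemma L0_one: "\<one>\<^bsub>L0 M\<^esub> = L0_class M (\<lambda>_. 1)"
  and L0_zero: "\<zero>\<^bsub>L0 M\<^esub> = L0_class M (\<lambda>_. 0)"
  by (simp_all add: L0_def)

lemma L0_cring: "cring (L0 M)"
proof (intro cringI abelian_groupI comm_monoidI)
  fix A assume "A \<in> carrier (L0 M)"
  then obtain f where f: "f \<in> borel_measurable M" "A = L0_class M f" by (rule L0_carrierE)
  have "L0_class M (\<lambda>w. - f w) \<oplus>\<^bsub>L0 M\<^esub> A = \<zero>\<^bsub>L0 M\<^esub>"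
    using f by (simp add: L0_add_class L0_zero)
  then show "\<exists>B\<in>carrier (L0 M). B \<oplus>\<^bsub>L0 M\<^esub> A = \<zero>\<^bsub>L0 M\<^esub>"
    using f by (intro bexI) (auto intro: L0_carrierI)
qed (auto elim!: L0_carrierE intro!: L0_carrierI
    simp: L0_add_class L0_mult_class L0_one L0_zero algebra_simps)

definition L0_cnj :: "'w measure \<Rightarrow> ('w \<Rightarrow> complex) set \<Rightarrow> ('w \<Rightarrow> complex) set"
  where "L0_cnj M = L0_map M cnj"

definition L0_abs :: "'w measure \<Rightarrow> ('w \<Rightarrow> complex) set \<Rightarrow> ('w \<Rightarrow> complex) set"
  where "L0_abs M = L0_map M (\<lambda>z. complex_of_real (cmod z))"

text \<open>Only applied to elements that are nonnegative for the order below.\<close>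

definition L0_sqrt :: "'w measure \<Rightarrow> ('w \<Rightarrow> complex) set \<Rightarrow> ('w \<Rightarrow> complex) set"
  where "L0_sqrt M = L0_map M (\<lambda>z. complex_of_real (sqrt (Re z)))"

text \<open>The order whose positive cone consists of the a.e. real and nonnegative functions;
  on real elements it is the usual a.e. order.\<close>

definition L0_le :: "'w measure \<Rightarrow> ('w \<Rightarrow> complex) set \<Rightarrow> ('w \<Rightarrow> complex) set \<Rightarrow> bool"
  where "L0_le M A B \<longleftrightarrow>
    (AE w in M. Re (L0_rep A w) \<le> Re (L0_rep B w) \<and> Im (L0_rep A w) = Im (L0_rep B w))"

definition L0_is_inf :: "'w measure \<Rightarrow> ('w \<Rightarrow> complex) set set \<Rightarrow> ('w \<Rightarrow> complex) set \<Rightarrow> bool"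
  where "L0_is_inf M E g \<longleftrightarrow>
    g \<in> carrier (L0 M) \<and> (\<forall>e\<in>E. L0_le M g e) \<and>
    (\<forall>c\<in>carrier (L0 M). (\<forall>e\<in>E. L0_le M c e) \<longrightarrow> L0_le M c g)"

definition L0_disjoint :: "'w measure \<Rightarrow> ('w \<Rightarrow> complex) set \<Rightarrow> ('w \<Rightarrow> complex) set \<Rightarrow> bool"
  where "L0_disjoint M a b \<longleftrightarrow> L0_is_inf M {a, b} \<zero>\<^bsub>L0 M\<^esub>"


section \<open>Nets and order convergence\<close>

definition directed_index :: "'i set \<Rightarrow> ('i \<Rightarrow> 'i \<Rightarrow> bool) \<Rightarrow> bool"
  where "directed_index I pr \<longleftrightarrow>
    I \<noteq> {} \<and> reflp_on I pr \<and> transp_on I pr \<and> (\<forall>i\<in>I. \<forall>j\<in>I. \<exists>k\<in>I. pr i k \<and> pr j k)"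

text \<open>A net \<open>a\<close> order converges to \<open>l\<close> if there is a net decreasing to \<open>0\<close> each of whose terms
  eventually bounds \<open>\<bar>a - l\<bar>\<close>. Only the range \<open>E\<close> of the decreasing net matters: it is a
  downward directed set with infimum \<open>0\<close>, and every such set is the range of a decreasing net.\<close>

definition o_tendsto :: "'w measure \<Rightarrow> 'i set \<Rightarrow> ('i \<Rightarrow> 'i \<Rightarrow> bool) \<Rightarrow>
    ('i \<Rightarrow> ('w \<Rightarrow> complex) set) \<Rightarrow> ('w \<Rightarrow> complex) set \<Rightarrow> bool"
  where "o_tendsto M I pr a l \<longleftrightarrow>
    (\<exists>E. E \<subseteq> carrier (L0 M) \<and> E \<noteq> {} \<and>
      (\<forall>d\<in>E. \<forall>e\<in>E. \<exists>c\<in>E. L0_le M c d \<and> L0_le M c e) \<and>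
      L0_is_inf M E \<zero>\<^bsub>L0 M\<^esub> \<and>
      (\<forall>e\<in>E. \<exists>i\<in>I. \<forall>j\<in>I. pr i j \<longrightarrow> L0_le M (L0_abs M (a j \<ominus>\<^bsub>L0 M\<^esub> l)) e))"


section \<open>Kaplansky-Hilbert modules\<close>

definition kh_norm :: "'w measure \<Rightarrow> ('x \<Rightarrow> 'x \<Rightarrow> ('w \<Rightarrow> complex) set) \<Rightarrow> 'x \<Rightarrow> ('w \<Rightarrow> complex) set"
  where "kh_norm M ip \<phi> = L0_sqrt M (ip \<phi> \<phi>)"

definition bo_tendsto :: "'w measure \<Rightarrow> (('w \<Rightarrow> complex) set, 'x) module \<Rightarrow>
    ('x \<Rightarrow> 'x \<Rightarrow> ('w \<Rightarrow> complex) set) \<Rightarrow>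
    'i set \<Rightarrow> ('i \<Rightarrow> 'i \<Rightarrow> bool) \<Rightarrow> ('i \<Rightarrow> 'x) \<Rightarrow> 'x \<Rightarrow> bool"
  where "bo_tendsto M X ip I pr \<phi> x \<longleftrightarrow>
    o_tendsto M I pr (\<lambda>i. kh_norm M ip (\<phi> i \<ominus>\<^bsub>X\<^esub> x)) \<zero>\<^bsub>L0 M\<^esub>"

definition bo_cauchy :: "'w measure \<Rightarrow> (('w \<Rightarrow> complex) set, 'x) module \<Rightarrow>
    ('x \<Rightarrow> 'x \<Rightarrow> ('w \<Rightarrow> complex) set) \<Rightarrow>
    'i set \<Rightarrow> ('i \<Rightarrow> 'i \<Rightarrow> bool) \<Rightarrow> ('i \<Rightarrow> 'x) \<Rightarrow> bool"
  where "bo_cauchy M X ip I pr \<phi> \<longleftrightarrow>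
    o_tendsto M (I \<times> I) (\<lambda>p q. pr (fst p) (fst q) \<and> pr (snd p) (snd q))
      (\<lambda>p. kh_norm M ip (\<phi> (fst p) \<ominus>\<^bsub>X\<^esub> \<phi> (snd p))) \<zero>\<^bsub>L0 M\<^esub>"

text \<open>HOL cannot quantify over the index types of nets inside a definition. Nets in \<open>'x\<close> are
  therefore indexed here by subsets of \<open>'x set \<times> 'x\<close>. This is no restriction, because every net can
  be reindexed by the pairs consisting of a tail and a point of that tail; see the lemmas
  \<open>bo_complete_net\<close> and \<open>bo_dense_net\<close> below, in which the index type is arbitrary.\<close>

definition bo_complete :: "'w measure \<Rightarrow> (('w \<Rightarrow> complex) set, 'x) module \<Rightarrow>
    ('x \<Rightarrow> 'x \<Rightarrow> ('w \<Rightarrow> complex) set) \<Rightarrow> bool"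
  where "bo_complete M X ip \<longleftrightarrow>
    (\<forall>(I :: ('x set \<times> 'x) set) pr \<phi>.
      directed_index I pr \<and> \<phi> \<in> I \<rightarrow> carrier X \<and> bo_cauchy M X ip I pr \<phi> \<longrightarrow>
      (\<exists>x\<in>carrier X. bo_tendsto M X ip I pr \<phi> x))"

definition bo_dense :: "'w measure \<Rightarrow> (('w \<Rightarrow> complex) set, 'x) module \<Rightarrow>
    ('x \<Rightarrow> 'x \<Rightarrow> ('w \<Rightarrow> complex) set) \<Rightarrow> 'x set \<Rightarrow> bool"
  where "bo_dense M X ip D \<longleftrightarrow> D \<subseteq> carrier X \<and>
    (\<forall>x\<in>carrier X. \<exists>(I :: ('x set \<times> 'x) set) pr \<phi>.
      directed_index I pr \<and> \<phi> \<in> I \<rightarrow> D \<and> bo_tendsto M X ip I pr \<phi> x)"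

locale kaplansky_hilbert_module = module "L0 M" X
  for M :: "'w measure"
    and X :: "(('w \<Rightarrow> complex) set, 'x) module" (structure) +
  fixes ip :: "'x \<Rightarrow> 'x \<Rightarrow> ('w \<Rightarrow> complex) set"
  assumes ip_closed: "\<lbrakk>\<phi> \<in> carrier X; \<psi> \<in> carrier X\<rbrakk> \<Longrightarrow> ip \<phi> \<psi> \<in> carrier (L0 M)"
    and ip_nonneg: "\<phi> \<in> carrier X \<Longrightarrow> L0_le M \<zero>\<^bsub>L0 M\<^esub> (ip \<phi> \<phi>)"
    and ip_eq_zero_iff: "\<phi> \<in> carrier X \<Longrightarrow> ip \<phi> \<phi> = \<zero>\<^bsub>L0 M\<^esub> \<longleftrightarrow> \<phi> = \<zero>"
    and ip_cnj: "\<lbrakk>\<phi> \<in> carrier X; \<psi> \<in> carrier X\<rbrakk> \<Longrightarrow> ip \<phi> \<psi> = L0_cnj M (ip \<psi> \<phi>)"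
    and ip_add: "\<lbrakk>\<phi> \<in> carrier X; \<psi> \<in> carrier X; \<zeta> \<in> carrier X\<rbrakk> \<Longrightarrow>
      ip (\<phi> \<oplus> \<psi>) \<zeta> = ip \<phi> \<zeta> \<oplus>\<^bsub>L0 M\<^esub> ip \<psi> \<zeta>"
    and ip_smult: "\<lbrakk>c \<in> carrier (L0 M); \<phi> \<in> carrier X; \<psi> \<in> carrier X\<rbrakk> \<Longrightarrow>
      ip (c \<odot> \<phi>) \<psi> = c \<otimes>\<^bsub>L0 M\<^esub> ip \<phi> \<psi>"
    and d_decomposable:
      "\<lbrakk>\<phi> \<in> carrier X; c \<in> carrier (L0 M); d \<in> carrier (L0 M);
        L0_le M \<zero>\<^bsub>L0 M\<^esub> c; L0_le M \<zero>\<^bsub>L0 M\<^esub> d; L0_disjoint M c d;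
        kh_norm M ip \<phi> = c \<oplus>\<^bsub>L0 M\<^esub> d\<rbrakk> \<Longrightarrow>
        \<exists>\<phi>1\<in>carrier X. \<exists>\<phi>2\<in>carrier X.
          \<phi> = \<phi>1 \<oplus> \<phi>2 \<and> kh_norm M ip \<phi>1 = c \<and> kh_norm M ip \<phi>2 = d"
    and bo_complete: "bo_complete M X ip"


section \<open>Operator algebras on a submodule\<close>

text \<open>Operators with domain \<open>D\<close> are extensional functions on \<open>D\<close>, so that equality of
  operators is equality in HOL.\<close>

definition linear_ops :: "('r, 's) ring_scheme \<Rightarrow> ('r, 'x) module \<Rightarrow> 'x set \<Rightarrow> ('x \<Rightarrow> 'x) set"
  where "linear_ops R X D = {a \<in> D \<rightarrow>\<^sub>E carrier X.
    (\<forall>\<phi>\<in>D. \<forall>\<psi>\<in>D. a (\<phi> \<oplus>\<^bsub>X\<^esub> \<psi>) = a \<phi> \<oplus>\<^bsub>X\<^esub> a \<psi>) \<and>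
    (\<forall>c\<in>carrier R. \<forall>\<phi>\<in>D. a (c \<odot>\<^bsub>X\<^esub> \<phi>) = c \<odot>\<^bsub>X\<^esub> a \<phi>)}"

definition adj_dom :: "('r, 'x) module \<Rightarrow> ('x \<Rightarrow> 'x \<Rightarrow> 'r) \<Rightarrow> 'x set \<Rightarrow> ('x \<Rightarrow> 'x) \<Rightarrow> 'x set"
  where "adj_dom X ip D a =
    {\<psi> \<in> carrier X. \<exists>\<eta>\<in>carrier X. \<forall>\<phi>\<in>D. ip (a \<phi>) \<psi> = ip \<phi> \<eta>}"

definition adj :: "('r, 'x) module \<Rightarrow> ('x \<Rightarrow> 'x \<Rightarrow> 'r) \<Rightarrow> 'x set \<Rightarrow> ('x \<Rightarrow> 'x) \<Rightarrow> 'x \<Rightarrow> 'x"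
  where "adj X ip D a \<psi> = (THE \<eta>. \<eta> \<in> carrier X \<and> (\<forall>\<phi>\<in>D. ip (a \<phi>) \<psi> = ip \<phi> \<eta>))"

definition Lplus :: "('r, 's) ring_scheme \<Rightarrow> ('r, 'x) module \<Rightarrow> ('x \<Rightarrow> 'x \<Rightarrow> 'r) \<Rightarrow> 'x set \<Rightarrow>
    ('r, 'x \<Rightarrow> 'x) module"
  where "Lplus R X ip D =
    \<lparr>carrier = {a \<in> linear_ops R X D.
       a ` D \<subseteq> D \<and> D \<subseteq> adj_dom X ip D a \<and> adj X ip D a ` D \<subseteq> D},
     mult = compose D,
     one = (\<lambda>\<phi>\<in>D. \<phi>),
     zero = (\<lambda>\<phi>\<in>D. \<zero>\<^bsub>X\<^esub>),
     add = (\<lambda>a b. \<lambda>\<phi>\<in>D. a \<phi> \<oplus>\<^bsub>X\<^esub> b \<phi>),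
     smult = (\<lambda>c a. \<lambda>\<phi>\<in>D. c \<odot>\<^bsub>X\<^esub> a \<phi>)\<rparr>"

definition module_span :: "('r, 's) ring_scheme \<Rightarrow> ('r, 'x) module \<Rightarrow> 'x set \<Rightarrow> 'x set"
  where "module_span R X S = {(\<Oplus>\<^bsub>X\<^esub>s\<in>S. c s \<odot>\<^bsub>X\<^esub> s) | c. c \<in> S \<rightarrow> carrier R}"

definition finite_rank_ops ::
    "('r, 's) ring_scheme \<Rightarrow> ('r, 'x) module \<Rightarrow> 'x set \<Rightarrow> ('x \<Rightarrow> 'x) set"
  where "finite_rank_ops R X D = {a \<in> linear_ops R X D. a ` D \<subseteq> D \<and>
    (\<exists>S. finite S \<and> S \<subseteq> carrier X \<and> a ` D = module_span R X S)}"

definition Fplus :: "('r, 's) ring_scheme \<Rightarrow> ('r, 'x) module \<Rightarrow> ('x \<Rightarrow> 'x \<Rightarrow> 'r) \<Rightarrow> 'x set \<Rightarrow>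
    ('x \<Rightarrow> 'x) set"
  where "Fplus R X ip D = finite_rank_ops R X D \<inter> carrier (Lplus R X ip D)"

text \<open>Subalgebras are not required to contain the unit. The locale \<^locale>\<open>algebra\<close> of the
  library is not used because it only covers commutative algebras.\<close>

definition subalgebra :: "'a set \<Rightarrow> ('r, 's) ring_scheme \<Rightarrow> ('r, 'a) module \<Rightarrow> bool"
  where "subalgebra U R A \<longleftrightarrow> submodule U R A \<and> (\<forall>a\<in>U. \<forall>b\<in>U. a \<otimes>\<^bsub>A\<^esub> b \<in> U)"

definition linear_derivation ::
    "('r, 's) ring_scheme \<Rightarrow> ('r, 'a) module \<Rightarrow> 'a set \<Rightarrow> ('a \<Rightarrow> 'a) \<Rightarrow> bool"
  where "linear_derivation R A U \<delta> \<longleftrightarrow> \<delta> \<in> U \<rightarrow> carrier A \<and>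
    (\<forall>a\<in>U. \<forall>b\<in>U. \<delta> (a \<oplus>\<^bsub>A\<^esub> b) = \<delta> a \<oplus>\<^bsub>A\<^esub> \<delta> b) \<and>
    (\<forall>c\<in>carrier R. \<forall>a\<in>U. \<delta> (c \<odot>\<^bsub>A\<^esub> a) = c \<odot>\<^bsub>A\<^esub> \<delta> a) \<and>
    (\<forall>a\<in>U. \<forall>b\<in>U. \<delta> (a \<otimes>\<^bsub>A\<^esub> b) = \<delta> a \<otimes>\<^bsub>A\<^esub> b \<oplus>\<^bsub>A\<^esub> a \<otimes>\<^bsub>A\<^esub> \<delta> b)"


section \<open>Independence of the index type of nets\<close>

definition tail_index :: "'i set \<Rightarrow> ('i \<Rightarrow> 'i \<Rightarrow> bool) \<Rightarrow> ('i \<Rightarrow> 'x) \<Rightarrow> ('x set \<times> 'x) set"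
  where "tail_index I pr \<phi> = (SIGMA T : (\<lambda>i. \<phi> ` {j \<in> I. pr i j}) ` I. T)"

definition tail_le :: "'x set \<times> 'x \<Rightarrow> 'x set \<times> 'x \<Rightarrow> bool"
  where "tail_le p q \<longleftrightarrow> fst q \<subseteq> fst p"

lemma tail_indexI:
  "\<lbrakk>i \<in> I; j \<in> I; pr i j\<rbrakk> \<Longrightarrow> (\<phi> ` {j \<in> I. pr i j}, \<phi> j) \<in> tail_index I pr \<phi>"
  by (auto simp: tail_index_def)

lemma tail_indexE:
  assumes "p \<in> tail_index I pr \<phi>"
  obtains i j where "i \<in> I" "j \<in> I" "pr i j" "p = (\<phi> ` {j \<in> I. pr i j}, \<phi> j)"
  using assms by (auto simp: tail_index_def)

lemma directed_index_tail:
  assumes "directed_index I pr"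
  shows "directed_index (tail_index I pr \<phi>) tail_le"
proof -
  have refl: "pr i i" if "i \<in> I" for i
    using assms that by (auto simp: directed_index_def dest: reflp_onD)
  have trans: "pr i k" if "pr i j" "pr j k" "i \<in> I" "j \<in> I" "k \<in> I" for i j k
    using assms that by (auto simp: directed_index_def dest: transp_onD)
  obtain i\<^sub>0 where "i\<^sub>0 \<in> I" using assms by (auto simp: directed_index_def)
  then have "tail_index I pr \<phi> \<noteq> {}"
    using tail_indexI[of i\<^sub>0 I i\<^sub>0 pr \<phi>] refl by blast
  moreover have "\<exists>r\<in>tail_index I pr \<phi>. tail_le p r \<and> tail_le q r"
    if p: "p \<in> tail_index I pr \<phi>" and q: "q \<in> tail_index I pr \<phi>" for p q
  proof -
    obtain i i' where i: "i \<in> I" "p = (\<phi> ` {j \<in> I. pr i j}, \<phi> i')"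
      using p by (rule tail_indexE)
    obtain j j' where j: "j \<in> I" "q = (\<phi> ` {k \<in> I. pr j k}, \<phi> j')"
      using q by (rule tail_indexE)
    obtain k where k: "k \<in> I" "pr i k" "pr j k"
      using assms i j by (auto simp: directed_index_def)
    have "(\<phi> ` {j \<in> I. pr k j}, \<phi> k) \<in> tail_index I pr \<phi>"
      using k refl by (intro tail_indexI)
    moreover have "tail_le p (\<phi> ` {j \<in> I. pr k j}, \<phi> k)"
      using i k trans[OF k(2)] unfolding tail_le_def by auto
    moreover have "tail_le q (\<phi> ` {j \<in> I. pr k j}, \<phi> k)"
      using j k trans[OF k(3)] unfolding tail_le_def by auto
    ultimately show ?thesis by blast
  qed
  ultimately show ?thesis
    by (auto simp: directed_index_def tail_le_def intro!: reflp_onI transp_onI)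
qed

lemma eventually_tail_iff:
  assumes "directed_index I pr"
  shows "(\<exists>p\<in>tail_index I pr \<phi>. \<forall>q\<in>tail_index I pr \<phi>. tail_le p q \<longrightarrow> P (snd q))
    \<longleftrightarrow> (\<exists>i\<in>I. \<forall>j\<in>I. pr i j \<longrightarrow> P (\<phi> j))" (is "?L \<longleftrightarrow> ?R")
proof
  assume ?L
  then obtain p where p: "p \<in> tail_index I pr \<phi>"
    and P: "\<And>q. q \<in> tail_index I pr \<phi> \<Longrightarrow> tail_le p q \<Longrightarrow> P (snd q)" by blast
  obtain i i' where i: "i \<in> I" "p = (\<phi> ` {j \<in> I. pr i j}, \<phi> i')"
    using p by (rule tail_indexE)
  have "P (\<phi> j)" if "j \<in> I" "pr i j" for j
    using P[OF tail_indexI[of i I j pr \<phi>]] i that by (simp add: tail_le_def)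
  with i show ?R by blast
next
  assume ?R
  then obtain i where i: "i \<in> I" "\<And>j. j \<in> I \<Longrightarrow> pr i j \<Longrightarrow> P (\<phi> j)" by blast
  have "pr i i" using assms i by (auto simp: directed_index_def dest: reflp_onD)
  then have "(\<phi> ` {j \<in> I. pr i j}, \<phi> i) \<in> tail_index I pr \<phi>"
    using i by (intro tail_indexI)
  moreover have "P (snd q)"
    if "q \<in> tail_index I pr \<phi>" "tail_le (\<phi> ` {j \<in> I. pr i j}, \<phi> i) q" for q
  proof -
    have "snd q \<in> fst q" using that(1) by (auto simp: tail_index_def)
    then show ?thesis using that(2) i(2) by (auto simp: tail_le_def)
  qed
  ultimately show ?L by blast
qed

lemma bo_tendsto_tail_iff:
  assumes "directed_index I pr"
  shows "bo_tendsto M X ip (tail_index I pr \<phi>) tail_le snd x \<longleftrightarrow> bo_tendsto M X ip I pr \<phi> x"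
  unfolding bo_tendsto_def o_tendsto_def
  by (simp only: eventually_tail_iff[OF assms, where P = "\<lambda>y. L0_le M (L0_abs M
    (kh_norm M ip (y \<ominus>\<^bsub>X\<^esub> x) \<ominus>\<^bsub>L0 M\<^esub> \<zero>\<^bsub>L0 M\<^esub>)) e" for e])

lemma bo_cauchy_tail:
  assumes "directed_index I pr" "bo_cauchy M X ip I pr \<phi>"
  shows "bo_cauchy M X ip (tail_index I pr \<phi>) tail_le snd"
proof -
  define Q where "Q e x y \<longleftrightarrow> L0_le M (L0_abs M
    (kh_norm M ip (x \<ominus>\<^bsub>X\<^esub> y) \<ominus>\<^bsub>L0 M\<^esub> \<zero>\<^bsub>L0 M\<^esub>)) e" for e x y
  let ?J = "tail_index I pr \<phi>"
  have *: "\<exists>p\<in>?J \<times> ?J. \<forall>q\<in>?J \<times> ?J. tail_le (fst p) (fst q) \<and> tail_le (snd p) (snd q) \<longrightarrow>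
      Q e (snd (fst q)) (snd (snd q))"
    if asm: "\<exists>p\<in>I \<times> I. \<forall>q\<in>I \<times> I. pr (fst p) (fst q) \<and> pr (snd p) (snd q) \<longrightarrow>
      Q e (\<phi> (fst q)) (\<phi> (snd q))" for e
  proof -
    obtain p where p: "p \<in> I \<times> I"
      "\<And>q. q \<in> I \<times> I \<Longrightarrow> pr (fst p) (fst q) \<and> pr (snd p) (snd q) \<Longrightarrow>
        Q e (\<phi> (fst q)) (\<phi> (snd q))"
      using asm by blast
    obtain i j where "p = (i, j)" by (cases p)
    then have ij: "i \<in> I" "j \<in> I"
      "\<And>k l. k \<in> I \<Longrightarrow> l \<in> I \<Longrightarrow> pr i k \<Longrightarrow> pr j l \<Longrightarrow> Q e (\<phi> k) (\<phi> l)"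
      using p(1) p(2)[of "(k, l)" for k l] by simp_all
    let ?p = "\<lambda>i. (\<phi> ` {j \<in> I. pr i j}, \<phi> i)"
    have refl: "pr i i" "pr j j"
      using assms(1) ij by (auto simp: directed_index_def dest: reflp_onD)
    have mem: "?p i \<in> ?J" "?p j \<in> ?J"
      using ij refl by (auto intro: tail_indexI)
    have "Q e (snd q) (snd r)"
      if "q \<in> ?J" "r \<in> ?J" "tail_le (?p i) q" "tail_le (?p j) r" for q r
    proof -
      have "snd q \<in> fst q" "snd r \<in> fst r"
        using that(1,2) by (auto simp: tail_index_def)
      then have "snd q \<in> \<phi> ` {k \<in> I. pr i k}" "snd r \<in> \<phi> ` {k \<in> I. pr j k}"
        using that(3,4) by (auto simp: tail_le_def)
      then show ?thesis using ij(3) by auto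
    qed
    then show ?thesis using mem by (intro bexI[of _ "(?p i, ?p j)"]) auto
  qed
  show ?thesis
    using assms(2) unfolding bo_cauchy_def o_tendsto_def Q_def[symmetric]
    by (elim exE conjE, intro exI conjI) (assumption | (rule ballI, rule *, erule bspec, assumption))+
qed

lemma bo_complete_net:
  assumes "bo_complete M X ip" "directed_index I pr" "\<phi> \<in> I \<rightarrow> carrier X"
    "bo_cauchy M X ip I pr \<phi>"
  shows "\<exists>x\<in>carrier X. bo_tendsto M X ip I pr \<phi> x"
proof -
  have "snd \<in> tail_index I pr \<phi> \<rightarrow> carrier X"
    using assms(3) by (auto simp: tail_index_def)
  then have "\<exists>x\<in>carrier X. bo_tendsto M X ip (tail_index I pr \<phi>) tail_le snd x"
    by (intro assms(1)[unfolded bo_complete_def, rule_format] conjI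
        directed_index_tail[OF assms(2)] bo_cauchy_tail[OF assms(2,4)])
  then show ?thesis
    by (simp only: bo_tendsto_tail_iff[OF assms(2)])
qed

lemma bo_dense_net:
  assumes "D \<subseteq> carrier X"
    and "\<And>x. x \<in> carrier X \<Longrightarrow> \<exists>(I :: 'i set) pr \<phi>.
      directed_index I pr \<and> \<phi> \<in> I \<rightarrow> D \<and> bo_tendsto M X ip I pr \<phi> x"
  shows "bo_dense M X ip D"
  unfolding bo_dense_def
proof (intro conjI ballI assms(1))
  fix x assume "x \<in> carrier X"
  then obtain I :: "'i set" and pr \<phi> where
    I: "directed_index I pr" "\<phi> \<in> I \<rightarrow> D" "bo_tendsto M X ip I pr \<phi> x"
    using assms(2) by blast
  have "snd \<in> tail_index I pr \<phi> \<rightarrow> D"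
    using I(2) by (auto simp: tail_index_def)
  then show "\<exists>(I :: ('a set \<times> 'a) set) pr \<phi>.
      directed_index I pr \<and> \<phi> \<in> I \<rightarrow> D \<and> bo_tendsto M X ip I pr \<phi> x"
    using directed_index_tail[OF I(1)] I(3)
    by (intro exI[of _ "tail_index I pr \<phi>"] exI[of _ tail_le] exI[of _ snd])
      (simp only: bo_tendsto_tail_iff[OF I(1)] simp_thms)
qed

end

theory Submission
  imports Defs
begin

text \<open>
  Write \<open>f \<otimes> g\<close> for the operator \<open>\<phi> \<mapsto> \<langle>\<phi>, g\<rangle> f\<close> and let \<open>\<langle>e, e\<rangle> = \<one>\<close>. A derivation that is of the
  form \<open>a \<mapsto> x a - a x\<close> determines \<open>x\<close> up to a central summand through its values on the operators
  \<open>\<phi> \<otimes> e\<close>; this suggests putting \<open>x \<phi> = \<delta> (\<phi> \<otimes> e) e\<close>. Since \<open>a (\<phi> \<otimes> e) = (a \<phi>) \<otimes> e\<close>, evaluating the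
  Leibniz rule for this product at \<open>e\<close> gives \<open>x (a \<phi>) = \<delta> a \<phi> + a (x \<phi>)\<close>, which is the assertion
  \<open>\<delta> a = x a - a x\<close>. The operators \<open>\<phi> \<otimes> e\<close> belong to \<open>\<U>\<close> because their range is generated by \<open>\<phi>\<close>.

  What needs an argument is that \<open>x\<close> has an adjoint mapping \<open>\<D>\<close> into itself
  (\<open>implementing_op_formal_adjoint\<close>). If \<open>e \<otimes> \<psi>\<close> lies in \<open>\<U>\<close>, then pairing
  \<open>\<delta> (e \<otimes> \<psi>) \<phi> = \<langle>\<phi>, \<psi>\<rangle> x e - \<langle>x \<phi>, \<psi>\<rangle> e\<close> with \<open>e\<close> expresses \<open>\<langle>x \<phi>, \<psi>\<rangle>\<close> as \<open>\<langle>\<phi>, \<eta>\<rangle>\<close> with \<open>\<eta> \<in> \<D>\<close>,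
  because \<open>\<delta> (e \<otimes> \<psi>)\<close> has an adjoint. The range of \<open>e \<otimes> \<psi>\<close> consists of the multiples of \<open>e\<close> by the
  ideal \<open>{\<langle>\<phi>, \<psi>\<rangle> | \<phi> \<in> \<D>}\<close>. Finding a generator of this ideal for arbitrary \<open>\<psi>\<close> would require a
  study of the support of \<open>\<psi>\<close>. This is avoided by treating only those \<open>\<psi>\<close> for which the ideal
  contains \<open>\<one>\<close> (\<open>rank_one_Fplus\<close>): they include \<open>e\<close> and \<open>\<psi> + (\<one> - \<langle>\<psi>, e\<rangle>) e\<close>, and these two
  vectors generate \<open>\<psi>\<close>.

  The density of \<open>\<D>\<close> enters through the uniqueness of adjoints: a vector orthogonal to a dense
  submodule vanishes, by the Pythagorean identity (\<open>orthogonal_to_dense_eq_zero\<close>). It allows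
  membership in the algebra of adjointable operators to be checked by exhibiting any formal
  adjoint (\<open>mem_Lplus_iff\<close>).
\<close>

section \<open>Arithmetic of classes of measurable functions\<close>

lemma L0_map_class:
  assumes [measurable]: "h \<in> borel_measurable borel" "f \<in> borel_measurable M"
  shows "L0_map M h (L0_class M f) = L0_class M (\<lambda>w. h (f w))"
proof -
  note [measurable] = L0_rep_class(1)
  show ?thesis
    using L0_rep_class(2)[OF assms(2)] unfolding L0_map_def
    by (subst L0_class_eq_iff) (auto elim: eventually_mono)
qed

lemma L0_cnj_class:
  "f \<in> borel_measurable M \<Longrightarrow> L0_cnj M (L0_class M f) = L0_class M (\<lambda>w. cnj (f w))"
  unfolding L0_cnj_def
  by (rule L0_map_class) (auto intro: borel_measurable_continuous_onI continuous_intros)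

lemma L0_abs_class:
  "f \<in> borel_measurable M \<Longrightarrow>
    L0_abs M (L0_class M f) = L0_class M (\<lambda>w. complex_of_real (cmod (f w)))"
  unfolding L0_abs_def by (rule L0_map_class) auto

lemma L0_sqrt_class:
  "f \<in> borel_measurable M \<Longrightarrow>
    L0_sqrt M (L0_class M f) = L0_class M (\<lambda>w. complex_of_real (sqrt (Re (f w))))"
  unfolding L0_sqrt_def
  by (rule L0_map_class) (auto intro: borel_measurable_continuous_onI continuous_intros)

lemma L0_le_class:
  assumes "f \<in> borel_measurable M" "g \<in> borel_measurable M"
  shows "L0_le M (L0_class M f) (L0_class M g) \<longleftrightarrow>
    (AE w in M. Re (f w) \<le> Re (g w) \<and> Im (f w) = Im (g w))"
proof -
  have "AE w in M. L0_rep (L0_class M f) w = f w \<and> L0_rep (L0_class M g) w = g w"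
    using L0_rep_class(2)[OF assms(1)] L0_rep_class(2)[OF assms(2)] by auto
  then show ?thesis
    unfolding L0_le_def by (intro eventually_cong) auto
qed

lemma L0_cnj_closed: "a \<in> carrier (L0 M) \<Longrightarrow> L0_cnj M a \<in> carrier (L0 M)"
  by (auto elim!: L0_carrierE simp: L0_cnj_class intro!: L0_carrierI
      borel_measurable_continuous_on[where f = cnj] continuous_intros)

lemma L0_cnj_cnj: "a \<in> carrier (L0 M) \<Longrightarrow> L0_cnj M (L0_cnj M a) = a"
  by (auto elim!: L0_carrierE simp: L0_cnj_class
      borel_measurable_continuous_on[where f = cnj] continuous_intros)

lemma L0_cnj_add:
  "a \<in> carrier (L0 M) \<Longrightarrow> b \<in> carrier (L0 M) \<Longrightarrow>
    L0_cnj M (a \<oplus>\<^bsub>L0 M\<^esub> b) = L0_cnj M a \<oplus>\<^bsub>L0 M\<^esub> L0_cnj M b"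
  by (auto elim!: L0_carrierE simp: L0_cnj_class L0_add_class
      borel_measurable_continuous_on[where f = cnj] continuous_intros)

lemma L0_cnj_mult:
  "a \<in> carrier (L0 M) \<Longrightarrow> b \<in> carrier (L0 M) \<Longrightarrow>
    L0_cnj M (a \<otimes>\<^bsub>L0 M\<^esub> b) = L0_cnj M a \<otimes>\<^bsub>L0 M\<^esub> L0_cnj M b"
  by (auto elim!: L0_carrierE simp: L0_cnj_class L0_mult_class
      borel_measurable_continuous_on[where f = cnj] continuous_intros)

lemma L0_cnj_one: "L0_cnj M \<one>\<^bsub>L0 M\<^esub> = \<one>\<^bsub>L0 M\<^esub>"
  and L0_cnj_zero: "L0_cnj M \<zero>\<^bsub>L0 M\<^esub> = \<zero>\<^bsub>L0 M\<^esub>"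
  by (simp_all add: L0_one L0_zero L0_cnj_class)

lemma L0_eq_one_if_sqrt_eq_one:
  assumes "a \<in> carrier (L0 M)" "L0_le M \<zero>\<^bsub>L0 M\<^esub> a" "L0_sqrt M a = \<one>\<^bsub>L0 M\<^esub>"
  shows "a = \<one>\<^bsub>L0 M\<^esub>"
proof -
  obtain f where f [measurable]: "f \<in> borel_measurable M" and a: "a = L0_class M f"
    using assms(1) by (rule L0_carrierE)
  have "AE w in M. complex_of_real (sqrt (Re (f w))) = 1"
    using assms(3) unfolding a L0_one L0_sqrt_class[OF f] by (subst (asm) L0_class_eq_iff) auto
  moreover have "AE w in M. 0 \<le> Re (f w) \<and> 0 = Im (f w)"
    using assms(2) unfolding a L0_zero by (subst (asm) L0_le_class) auto
  ultimately have "AE w in M. f w = 1"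
    by eventually_elim (auto simp: complex_eq_iff)
  then show ?thesis unfolding a L0_one by (subst L0_class_eq_iff) auto
qed

lemma L0_eq_zero_if_sqrt_le_zero:
  assumes "a \<in> carrier (L0 M)" "L0_le M \<zero>\<^bsub>L0 M\<^esub> a" "L0_le M (L0_sqrt M a) \<zero>\<^bsub>L0 M\<^esub>"
  shows "a = \<zero>\<^bsub>L0 M\<^esub>"
proof -
  obtain f where f [measurable]: "f \<in> borel_measurable M" and a: "a = L0_class M f"
    using assms(1) by (rule L0_carrierE)
  have "AE w in M. sqrt (Re (f w)) \<le> 0"
    using assms(3) unfolding a L0_zero L0_sqrt_class[OF f] by (subst (asm) L0_le_class) auto
  moreover have "AE w in M. 0 \<le> Re (f w) \<and> 0 = Im (f w)"
    using assms(2) unfolding a L0_zero by (subst (asm) L0_le_class) auto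
  ultimately have "AE w in M. f w = 0"
    by eventually_elim (auto simp: complex_eq_iff)
  then show ?thesis unfolding a L0_zero by (subst L0_class_eq_iff) auto
qed

text \<open>The absolute value and the subtraction of zero on the right-hand side are how the
  definition of order convergence to zero presents a nonnegative net.\<close>

lemma L0_sqrt_le_abs_sqrt_add:
  assumes "a \<in> carrier (L0 M)" "b \<in> carrier (L0 M)" "L0_le M \<zero>\<^bsub>L0 M\<^esub> a"
  shows "L0_le M (L0_sqrt M b) (L0_abs M (L0_sqrt M (a \<oplus>\<^bsub>L0 M\<^esub> b) \<ominus>\<^bsub>L0 M\<^esub> \<zero>\<^bsub>L0 M\<^esub>))"
proof -
  interpret L: cring "L0 M" by (rule L0_cring)
  obtain f where f [measurable]: "f \<in> borel_measurable M" and a: "a = L0_class M f"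
    using assms(1) by (rule L0_carrierE)
  obtain g where g [measurable]: "g \<in> borel_measurable M" and b: "b = L0_class M g"
    using assms(2) by (rule L0_carrierE)
  have "AE w in M. 0 \<le> Re (f w)"
    using assms(3) unfolding a L0_zero by (subst (asm) L0_le_class) auto
  then have "AE w in M. sqrt (Re (g w)) \<le> \<bar>sqrt (Re (f w + g w))\<bar>"
    by eventually_elim (auto intro: order.trans[OF _ abs_ge_self])
  moreover have "L0_sqrt M (a \<oplus>\<^bsub>L0 M\<^esub> b) = L0_class M (\<lambda>w. complex_of_real (sqrt (Re (f w + g w))))"
    unfolding a b by (simp add: L0_add_class L0_sqrt_class)
  moreover have "c \<ominus>\<^bsub>L0 M\<^esub> \<zero>\<^bsub>L0 M\<^esub> = c" if "c \<in> carrier (L0 M)" for c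
    using that by (simp add: L.minus_eq)
  ultimately show ?thesis
    by (simp add: b L0_sqrt_class L0_abs_class L0_carrierI L0_le_class)
qed

lemma L0_le_trans: "L0_le M a b \<Longrightarrow> L0_le M b c \<Longrightarrow> L0_le M a c"
  unfolding L0_le_def by (erule (1) eventually_elim2) auto

section \<open>The inner product\<close>

context kaplansky_hilbert_module
begin

lemma ip_add_right:
  assumes "\<phi> \<in> carrier X" "\<psi> \<in> carrier X" "\<zeta> \<in> carrier X"
  shows "ip \<zeta> (\<phi> \<oplus> \<psi>) = ip \<zeta> \<phi> \<oplus>\<^bsub>L0 M\<^esub> ip \<zeta> \<psi>"
  using assms by (simp add: ip_cnj[of \<zeta>] ip_add L0_cnj_add ip_closed)

lemma ip_smult_right:
  assumes "c \<in> carrier (L0 M)" "\<phi> \<in> carrier X" "\<zeta> \<in> carrier X"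
  shows "ip \<zeta> (c \<odot> \<phi>) = L0_cnj M c \<otimes>\<^bsub>L0 M\<^esub> ip \<zeta> \<phi>"
  using assms by (simp add: ip_cnj[of \<zeta>] ip_smult L0_cnj_mult ip_closed)

lemma ip_zero_left: "\<psi> \<in> carrier X \<Longrightarrow> ip \<zero> \<psi> = \<zero>\<^bsub>L0 M\<^esub>"
  using ip_smult[of "\<zero>\<^bsub>L0 M\<^esub>" \<zero> \<psi>] by (simp add: ip_closed)

lemma ip_zero_right: "\<psi> \<in> carrier X \<Longrightarrow> ip \<psi> \<zero> = \<zero>\<^bsub>L0 M\<^esub>"
  by (simp add: ip_cnj[of \<psi>] ip_zero_left L0_cnj_zero)

lemma ip_minus_left:
  assumes "\<phi> \<in> carrier X" "\<psi> \<in> carrier X"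
  shows "ip (\<ominus> \<phi>) \<psi> = \<ominus>\<^bsub>L0 M\<^esub> ip \<phi> \<psi>"
  using ip_add[of "\<ominus> \<phi>" \<phi> \<psi>] assms
  by (intro R.minus_equality[symmetric]) (auto simp: M.l_neg ip_zero_left ip_closed)

lemma ip_minus_right:
  assumes "\<phi> \<in> carrier X" "\<psi> \<in> carrier X"
  shows "ip \<psi> (\<ominus> \<phi>) = \<ominus>\<^bsub>L0 M\<^esub> ip \<psi> \<phi>"
  using ip_add_right[of "\<ominus> \<phi>" \<phi> \<psi>] assms
  by (intro R.minus_equality[symmetric]) (auto simp: M.l_neg ip_zero_right ip_closed)

lemma ip_self_eq_one:
  assumes "\<phi> \<in> carrier X" "kh_norm M ip \<phi> = \<one>\<^bsub>L0 M\<^esub>"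
  shows "ip \<phi> \<phi> = \<one>\<^bsub>L0 M\<^esub>"
  using L0_eq_one_if_sqrt_eq_one[OF ip_closed ip_nonneg] assms by (simp add: kh_norm_def)

lemma ip_diff_orthogonal:
  assumes "\<phi> \<in> carrier X" "\<eta> \<in> carrier X" "ip \<phi> \<eta> = \<zero>\<^bsub>L0 M\<^esub>"
  shows "ip (\<phi> \<ominus> \<eta>) (\<phi> \<ominus> \<eta>) = ip \<phi> \<phi> \<oplus>\<^bsub>L0 M\<^esub> ip \<eta> \<eta>"
proof -
  have "ip \<eta> \<phi> = \<zero>\<^bsub>L0 M\<^esub>"
    using assms by (simp add: ip_cnj[of \<eta>] L0_cnj_zero)
  then show ?thesis
    using assms
    by (simp add: M.minus_eq ip_add ip_add_right ip_minus_left ip_minus_right ip_closed)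
qed

text \<open>By the Pythagorean identity the distance of \<open>\<eta>\<close> to any vector orthogonal to it is at least
  \<open>\<parallel>\<eta>\<parallel>\<close>, so a net of such vectors can only converge to \<open>\<eta>\<close> if \<open>\<parallel>\<eta>\<parallel> \<le> 0\<close>.\<close>

lemma orthogonal_to_dense_eq_zero:
  assumes dense: "bo_dense M X ip D" and \<eta>: "\<eta> \<in> carrier X"
    and orth: "\<And>\<phi>. \<phi> \<in> D \<Longrightarrow> ip \<phi> \<eta> = \<zero>\<^bsub>L0 M\<^esub>"
  shows "\<eta> = \<zero>"
proof -
  obtain I :: "('x set \<times> 'x) set" and pr \<phi>
    where I: "directed_index I pr" "\<phi> \<in> I \<rightarrow> D" "bo_tendsto M X ip I pr \<phi> \<eta>"
    using dense \<eta> unfolding bo_dense_def by blast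
  obtain E where inf: "L0_is_inf M E \<zero>\<^bsub>L0 M\<^esub>"
    and E: "\<And>c. c \<in> E \<Longrightarrow> \<exists>i\<in>I. \<forall>j\<in>I. pr i j \<longrightarrow>
        L0_le M (L0_abs M (kh_norm M ip (\<phi> j \<ominus> \<eta>) \<ominus>\<^bsub>L0 M\<^esub> \<zero>\<^bsub>L0 M\<^esub>)) c"
    using I(3) unfolding bo_tendsto_def o_tendsto_def by blast
  have "L0_le M (kh_norm M ip \<eta>) c" if c: "c \<in> E" for c
  proof -
    obtain i where i: "i \<in> I" "\<And>j. j \<in> I \<Longrightarrow> pr i j \<Longrightarrow>
        L0_le M (L0_abs M (kh_norm M ip (\<phi> j \<ominus> \<eta>) \<ominus>\<^bsub>L0 M\<^esub> \<zero>\<^bsub>L0 M\<^esub>)) c"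
      using E[OF c] by blast
    have "pr i i" using I(1) i(1) by (auto simp: directed_index_def dest: reflp_onD)
    then have le: "L0_le M (L0_abs M (kh_norm M ip (\<phi> i \<ominus> \<eta>) \<ominus>\<^bsub>L0 M\<^esub> \<zero>\<^bsub>L0 M\<^esub>)) c"
      using i by blast
    have "\<phi> i \<in> D" using I(2) i(1) by auto
    moreover from this have "\<phi> i \<in> carrier X" using dense by (auto simp: bo_dense_def)
    ultimately have "L0_le M (kh_norm M ip \<eta>)
        (L0_abs M (kh_norm M ip (\<phi> i \<ominus> \<eta>) \<ominus>\<^bsub>L0 M\<^esub> \<zero>\<^bsub>L0 M\<^esub>))"
      unfolding kh_norm_def
      by (simp add: ip_diff_orthogonal \<eta> orth L0_sqrt_le_abs_sqrt_add ip_closed ip_nonneg)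
    then show ?thesis using le by (rule L0_le_trans)
  qed
  moreover have "kh_norm M ip \<eta> \<in> carrier (L0 M)"
    using ip_closed[OF \<eta> \<eta>]
    by (auto elim!: L0_carrierE intro!: L0_carrierI simp: kh_norm_def L0_sqrt_class)
  ultimately have "L0_le M (kh_norm M ip \<eta>) \<zero>\<^bsub>L0 M\<^esub>"
    using inf by (auto simp: L0_is_inf_def)
  then have "ip \<eta> \<eta> = \<zero>\<^bsub>L0 M\<^esub>"
    unfolding kh_norm_def by (intro L0_eq_zero_if_sqrt_le_zero ip_closed ip_nonneg \<eta>)
  then show ?thesis using \<eta> by (simp add: ip_eq_zero_iff)
qed

end

section \<open>Adjointable operators on a dense submodule\<close>

locale dense_domain = kaplansky_hilbert_module M X ip
  for M :: "'w measure"
    and X :: "(('w \<Rightarrow> complex) set, 'x) module" (structure)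
    and ip :: "'x \<Rightarrow> 'x \<Rightarrow> ('w \<Rightarrow> complex) set" +
  fixes D :: "'x set"
  assumes submodule_D: "submodule D (L0 M) X"
    and dense_D: "bo_dense M X ip D"
begin

abbreviation A where "A \<equiv> Lplus (L0 M) X ip D"

lemma D_carrier: "\<phi> \<in> D \<Longrightarrow> \<phi> \<in> carrier X"
  using submoduleE(1)[OF submodule_D] by blast

lemma D_add: "\<phi> \<in> D \<Longrightarrow> \<psi> \<in> D \<Longrightarrow> \<phi> \<oplus> \<psi> \<in> D"
  by (rule submoduleE(5)[OF submodule_D])

lemma D_smult: "c \<in> carrier (L0 M) \<Longrightarrow> \<phi> \<in> D \<Longrightarrow> c \<odot> \<phi> \<in> D"
  by (rule submoduleE(4)[OF submodule_D])

lemma D_minus: "\<phi> \<in> D \<Longrightarrow> \<ominus> \<phi> \<in> D"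
  by (rule submoduleE(3)[OF submodule_D])

lemma D_zero: "\<zero> \<in> D"
  using submoduleE(2)[OF submodule_D] D_add D_minus D_carrier M.r_neg by (metis all_not_in_conv)

lemmas D_closed = D_carrier D_add D_smult D_minus D_zero

lemma ip_D_closed: "\<phi> \<in> D \<Longrightarrow> \<psi> \<in> D \<Longrightarrow> ip \<phi> \<psi> \<in> carrier (L0 M)"
  by (simp add: ip_closed D_carrier)

lemma eq_if_ip_eq_on_D:
  assumes "\<eta> \<in> carrier X" "\<eta>' \<in> carrier X" "\<And>\<phi>. \<phi> \<in> D \<Longrightarrow> ip \<phi> \<eta> = ip \<phi> \<eta>'"
  shows "\<eta> = \<eta>'"
proof -
  have "\<eta> \<ominus> \<eta>' = \<zero>"
    using assms
    by (intro orthogonal_to_dense_eq_zero[OF dense_D])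
      (auto simp: M.minus_eq ip_add_right ip_minus_right D_carrier ip_closed R.r_neg)
  then show ?thesis using assms by (metis M.minus_eq M.minus_equality M.minus_minus M.a_inv_closed)
qed

lemma adj_eqI:
  assumes "\<eta> \<in> carrier X" "\<And>\<phi>. \<phi> \<in> D \<Longrightarrow> ip (a \<phi>) \<psi> = ip \<phi> \<eta>"
  shows "adj X ip D a \<psi> = \<eta>"
  unfolding adj_def
proof (rule the_equality)
  show "\<eta> \<in> carrier X \<and> (\<forall>\<phi>\<in>D. ip (a \<phi>) \<psi> = ip \<phi> \<eta>)" using assms by blast
  show "\<eta>' = \<eta>" if "\<eta>' \<in> carrier X \<and> (\<forall>\<phi>\<in>D. ip (a \<phi>) \<psi> = ip \<phi> \<eta>')" for \<eta>'
    using that assms by (intro eq_if_ip_eq_on_D) auto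
qed

text \<open>Since adjoints are unique, it is enough to find, vector by vector, some element of \<open>D\<close>
  that represents \<open>\<phi> \<mapsto> \<langle>a \<phi>, \<psi>\<rangle>\<close>.\<close>

lemma mem_Lplus_iff:
  "a \<in> carrier A \<longleftrightarrow> a \<in> linear_ops (L0 M) X D \<and> a ` D \<subseteq> D \<and>
    (\<forall>\<psi>\<in>D. \<exists>\<eta>\<in>D. \<forall>\<phi>\<in>D. ip (a \<phi>) \<psi> = ip \<phi> \<eta>)" (is "_ \<longleftrightarrow> ?R")
proof
  assume a: "a \<in> carrier A"
  have "\<forall>\<psi>\<in>D. \<exists>\<eta>\<in>D. \<forall>\<phi>\<in>D. ip (a \<phi>) \<psi> = ip \<phi> \<eta>"
  proof
    fix \<psi> assume \<psi>: "\<psi> \<in> D"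
    obtain \<eta> where \<eta>: "\<eta> \<in> carrier X" "\<And>\<phi>. \<phi> \<in> D \<Longrightarrow> ip (a \<phi>) \<psi> = ip \<phi> \<eta>"
      using a \<psi> by (auto simp: Lplus_def adj_dom_def)
    moreover have "adj X ip D a \<psi> \<in> D"
      using a \<psi> by (auto simp: Lplus_def)
    moreover have "adj X ip D a \<psi> = \<eta>" using \<eta> by (rule adj_eqI)
    ultimately show "\<exists>\<eta>\<in>D. \<forall>\<phi>\<in>D. ip (a \<phi>) \<psi> = ip \<phi> \<eta>" by blast
  qed
  moreover have "a \<in> linear_ops (L0 M) X D \<and> a ` D \<subseteq> D"
    using a by (simp add: Lplus_def)
  ultimately show ?R by (elim conjE, intro conjI)
next
  assume R: ?R
  have "\<psi> \<in> adj_dom X ip D a \<and> adj X ip D a \<psi> \<in> D" if \<psi>: "\<psi> \<in> D" for \<psi>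
  proof -
    obtain \<eta> where \<eta>: "\<eta> \<in> D" "\<forall>\<phi>\<in>D. ip (a \<phi>) \<psi> = ip \<phi> \<eta>"
      using R[THEN conjunct2, THEN conjunct2, THEN bspec, OF \<psi>] by (elim bexE)
    then have "adj X ip D a \<psi> = \<eta>"
      using D_carrier by (intro adj_eqI) simp_all
    moreover have "\<psi> \<in> adj_dom X ip D a"
      using \<eta> \<psi> D_carrier unfolding adj_dom_def by auto
    ultimately show ?thesis using \<eta>(1) by simp
  qed
  then have "D \<subseteq> adj_dom X ip D a" "adj X ip D a ` D \<subseteq> D"
    by blast+
  with R show "a \<in> carrier A" by (simp add: Lplus_def)
qed

lemma LplusI:
  assumes "a \<in> extensional D" "\<And>\<phi>. \<phi> \<in> D \<Longrightarrow> a \<phi> \<in> D"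
    and "\<And>\<phi> \<psi>. \<phi> \<in> D \<Longrightarrow> \<psi> \<in> D \<Longrightarrow> a (\<phi> \<oplus> \<psi>) = a \<phi> \<oplus> a \<psi>"
    and "\<And>c \<phi>. c \<in> carrier (L0 M) \<Longrightarrow> \<phi> \<in> D \<Longrightarrow> a (c \<odot> \<phi>) = c \<odot> a \<phi>"
    and "\<And>\<psi>. \<psi> \<in> D \<Longrightarrow> \<exists>\<eta>\<in>D. \<forall>\<phi>\<in>D. ip (a \<phi>) \<psi> = ip \<phi> \<eta>"
  shows "a \<in> carrier A"
proof -
  have "a \<in> linear_ops (L0 M) X D"
    unfolding linear_ops_def using assms(1-4) D_carrier by (auto simp: PiE_def)
  moreover have "a ` D \<subseteq> D" using assms(2) by blast
  ultimately show ?thesis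
    unfolding mem_Lplus_iff using assms(5) by (intro conjI ballI)
qed

context
  fixes a assumes a: "a \<in> carrier A"
begin

lemma Lplus_extensional: "a \<in> extensional D"
  using a by (auto simp: Lplus_def linear_ops_def PiE_def)

lemma Lplus_maps: "\<phi> \<in> D \<Longrightarrow> a \<phi> \<in> D"
  using a by (auto simp: Lplus_def)

lemma Lplus_add_arg: "\<phi> \<in> D \<Longrightarrow> \<psi> \<in> D \<Longrightarrow> a (\<phi> \<oplus> \<psi>) = a \<phi> \<oplus> a \<psi>"
  using a by (auto simp: Lplus_def linear_ops_def)

lemma Lplus_smult_arg: "c \<in> carrier (L0 M) \<Longrightarrow> \<phi> \<in> D \<Longrightarrow> a (c \<odot> \<phi>) = c \<odot> a \<phi>"
  using a by (auto simp: Lplus_def linear_ops_def)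

lemma Lplus_formal_adjoint:
  assumes "\<psi> \<in> D"
  obtains \<eta> where "\<eta> \<in> D" "\<And>\<phi>. \<phi> \<in> D \<Longrightarrow> ip (a \<phi>) \<psi> = ip \<phi> \<eta>"
proof -
  have "\<exists>\<eta>\<in>D. \<forall>\<phi>\<in>D. ip (a \<phi>) \<psi> = ip \<phi> \<eta>"
    using a[unfolded mem_Lplus_iff, THEN conjunct2, THEN conjunct2, THEN bspec, OF assms] .
  then show thesis by (elim bexE) (rule that, assumption, erule (1) bspec)
qed

end

lemmas LplusD = Lplus_extensional Lplus_maps Lplus_add_arg Lplus_smult_arg

lemma Lplus_eqI:
  assumes "a \<in> carrier A" "b \<in> carrier A" "\<And>\<phi>. \<phi> \<in> D \<Longrightarrow> a \<phi> = b \<phi>"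
  shows "a = b"
  using Lplus_extensional[OF assms(1)] Lplus_extensional[OF assms(2)] assms(3)
  by (rule extensionalityI)

lemma Lplus_apply:
  assumes "\<phi> \<in> D"
  shows "(a \<oplus>\<^bsub>A\<^esub> b) \<phi> = a \<phi> \<oplus> b \<phi>" "(a \<otimes>\<^bsub>A\<^esub> b) \<phi> = a (b \<phi>)"
    "(c \<odot>\<^bsub>A\<^esub> a) \<phi> = c \<odot> a \<phi>" "\<zero>\<^bsub>A\<^esub> \<phi> = \<zero>"
  using assms by (simp_all add: Lplus_def compose_def)

lemma Lplus_add_closed:
  assumes "a \<in> carrier A" "b \<in> carrier A"
  shows "a \<oplus>\<^bsub>A\<^esub> b \<in> carrier A"
proof (rule LplusI)
  fix \<psi> assume \<psi>: "\<psi> \<in> D"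
  obtain \<eta> where \<eta>: "\<eta> \<in> D" "\<And>\<phi>. \<phi> \<in> D \<Longrightarrow> ip (a \<phi>) \<psi> = ip \<phi> \<eta>"
    using Lplus_formal_adjoint[OF assms(1) \<psi>] by blast
  obtain \<zeta> where \<zeta>: "\<zeta> \<in> D" "\<And>\<phi>. \<phi> \<in> D \<Longrightarrow> ip (b \<phi>) \<psi> = ip \<phi> \<zeta>"
    using Lplus_formal_adjoint[OF assms(2) \<psi>] by blast
  show "\<exists>\<eta>\<in>D. \<forall>\<phi>\<in>D. ip ((a \<oplus>\<^bsub>A\<^esub> b) \<phi>) \<psi> = ip \<phi> \<eta>"
    using assms \<psi> \<eta> \<zeta>
    by (intro bexI[of _ "\<eta> \<oplus> \<zeta>"])
      (auto simp: Lplus_apply ip_add ip_add_right D_closed Lplus_maps)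
qed (use assms in \<open>auto simp: Lplus_apply LplusD D_closed M.add.m_ac smult_r_distr,
    auto simp: Lplus_def\<close>)

lemma Lplus_mult_closed:
  assumes "a \<in> carrier A" "b \<in> carrier A"
  shows "a \<otimes>\<^bsub>A\<^esub> b \<in> carrier A"
proof (rule LplusI)
  fix \<psi> assume \<psi>: "\<psi> \<in> D"
  obtain \<eta> where \<eta>: "\<eta> \<in> D" "\<And>\<phi>. \<phi> \<in> D \<Longrightarrow> ip (a \<phi>) \<psi> = ip \<phi> \<eta>"
    using Lplus_formal_adjoint[OF assms(1) \<psi>] by blast
  obtain \<zeta> where \<zeta>: "\<zeta> \<in> D" "\<And>\<phi>. \<phi> \<in> D \<Longrightarrow> ip (b \<phi>) \<eta> = ip \<phi> \<zeta>"
    using Lplus_formal_adjoint[OF assms(2) \<eta>(1)] by blast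
  show "\<exists>\<eta>\<in>D. \<forall>\<phi>\<in>D. ip ((a \<otimes>\<^bsub>A\<^esub> b) \<phi>) \<psi> = ip \<phi> \<eta>"
    using assms \<psi> \<eta> \<zeta> by (intro bexI[of _ \<zeta>]) (auto simp: Lplus_apply Lplus_maps)
qed (use assms in \<open>auto simp: Lplus_apply LplusD D_closed, auto simp: Lplus_def\<close>)

lemma Lplus_smult_closed:
  assumes "c \<in> carrier (L0 M)" "a \<in> carrier A"
  shows "c \<odot>\<^bsub>A\<^esub> a \<in> carrier A"
proof (rule LplusI)
  fix \<psi> assume \<psi>: "\<psi> \<in> D"
  obtain \<eta> where \<eta>: "\<eta> \<in> D" "\<And>\<phi>. \<phi> \<in> D \<Longrightarrow> ip (a \<phi>) \<psi> = ip \<phi> \<eta>"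
    using Lplus_formal_adjoint[OF assms(2) \<psi>] by blast
  show "\<exists>\<eta>\<in>D. \<forall>\<phi>\<in>D. ip ((c \<odot>\<^bsub>A\<^esub> a) \<phi>) \<psi> = ip \<phi> \<eta>"
    using assms \<psi> \<eta>
    by (intro bexI[of _ "L0_cnj M c \<odot> \<eta>"])
      (auto simp: Lplus_apply ip_smult ip_smult_right D_closed Lplus_maps L0_cnj_cnj L0_cnj_closed)
qed (use assms in \<open>auto simp: Lplus_apply LplusD D_closed smult_r_distr
    smult_assoc1[symmetric] R.m_comm, auto simp: Lplus_def\<close>)

lemma Lplus_zero_closed: "\<zero>\<^bsub>A\<^esub> \<in> carrier A"
proof (rule LplusI)
  show "\<exists>\<eta>\<in>D. \<forall>\<phi>\<in>D. ip (\<zero>\<^bsub>A\<^esub> \<phi>) \<psi> = ip \<phi> \<eta>" if "\<psi> \<in> D" for \<psi>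
    using that by (intro bexI[of _ \<zero>])
      (auto simp: Lplus_apply ip_zero_left ip_zero_right D_closed)
qed (auto simp: Lplus_apply D_closed, auto simp: Lplus_def)

lemma Lplus_abelian_group: "abelian_group A"
proof (rule abelian_groupI)
  fix a assume a: "a \<in> carrier A"
  have "\<ominus>\<^bsub>L0 M\<^esub> \<one>\<^bsub>L0 M\<^esub> \<odot>\<^bsub>A\<^esub> a \<oplus>\<^bsub>A\<^esub> a = \<zero>\<^bsub>A\<^esub>"
    using a by (intro Lplus_eqI Lplus_add_closed Lplus_smult_closed Lplus_zero_closed)
      (auto simp: Lplus_apply smult_l_minus Lplus_maps D_carrier M.l_neg)
  then show "\<exists>b\<in>carrier A. b \<oplus>\<^bsub>A\<^esub> a = \<zero>\<^bsub>A\<^esub>"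
    using a by (intro bexI[of _ "\<ominus>\<^bsub>L0 M\<^esub> \<one>\<^bsub>L0 M\<^esub> \<odot>\<^bsub>A\<^esub> a"]) (auto intro: Lplus_smult_closed)
qed (auto intro!: Lplus_add_closed Lplus_zero_closed Lplus_eqI
    simp: Lplus_apply Lplus_maps D_carrier M.add.m_ac)

lemma subalgebra_carrier_Lplus: "subalgebra (carrier A) (L0 M) A"
proof -
  interpret Lp: abelian_group A by (rule Lplus_abelian_group)
  show ?thesis
    unfolding subalgebra_def submodule_def submodule_axioms_def
    using Lp.add.subgroup_self Lplus_smult_closed Lplus_mult_closed by simp
qed

section \<open>Operators of rank one\<close>

definition rank_one :: "'x \<Rightarrow> 'x \<Rightarrow> 'x \<Rightarrow> 'x"
  where "rank_one f g = (\<lambda>\<phi>\<in>D. ip \<phi> g \<odot> f)"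

lemma rank_one_apply: "\<phi> \<in> D \<Longrightarrow> rank_one f g \<phi> = ip \<phi> g \<odot> f"
  by (simp add: rank_one_def)

lemma rank_one_Lplus:
  assumes "f \<in> D" "g \<in> D"
  shows "rank_one f g \<in> carrier A"
proof (rule LplusI)
  fix \<psi> assume \<psi>: "\<psi> \<in> D"
  have "ip (rank_one f g \<phi>) \<psi> = ip \<phi> (ip \<psi> f \<odot> g)" if "\<phi> \<in> D" for \<phi>
    using assms \<psi> that ip_cnj[of f \<psi>]
    by (simp add: rank_one_apply ip_smult ip_smult_right D_closed ip_D_closed L0_cnj_closed R.m_comm)
  then show "\<exists>\<eta>\<in>D. \<forall>\<phi>\<in>D. ip (rank_one f g \<phi>) \<psi> = ip \<phi> \<eta>"
    using assms \<psi> by (intro bexI[of _ "ip \<psi> f \<odot> g"]) (auto simp: D_closed ip_D_closed)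
qed (use assms in \<open>auto simp: rank_one_apply D_closed ip_D_closed ip_add ip_smult
    smult_l_distr smult_assoc1, auto simp: rank_one_def\<close>)

text \<open>If \<open>\<langle>h, g\<rangle> = \<one>\<close>, then \<open>c f\<close> is the value at \<open>c h\<close>, so that the range is generated by \<open>f\<close>.\<close>

lemma rank_one_Fplus:
  assumes f: "f \<in> D" and g: "g \<in> D" and h: "h \<in> D" "ip h g = \<one>\<^bsub>L0 M\<^esub>"
  shows "rank_one f g \<in> Fplus (L0 M) X ip D"
proof -
  have span: "module_span (L0 M) X {f} = {c \<odot> f | c. c \<in> carrier (L0 M)}"
  proof -
    have sum: "(\<Oplus>s\<in>{f}. c s \<odot> s) = c f \<odot> f" if "c f \<in> carrier (L0 M)" for c
      using that f by (simp add: D_carrier)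
    show ?thesis
    proof (intro subset_antisym subsetI)
      fix \<phi> assume "\<phi> \<in> module_span (L0 M) X {f}"
      then obtain c where "c f \<in> carrier (L0 M)" "\<phi> = (\<Oplus>s\<in>{f}. c s \<odot> s)"
        unfolding module_span_def by auto
      then show "\<phi> \<in> {c \<odot> f | c. c \<in> carrier (L0 M)}"
        using sum[of c] by auto
    next
      fix \<phi> assume "\<phi> \<in> {c \<odot> f | c. c \<in> carrier (L0 M)}"
      then obtain c where "c \<in> carrier (L0 M)" "\<phi> = c \<odot> f"
        by auto
      then show "\<phi> \<in> module_span (L0 M) X {f}"
        using sum[of "\<lambda>_. c"] unfolding module_span_def by (auto intro!: exI[of _ "\<lambda>_. c"])
    qed
  qed
  have "c \<odot> f = rank_one f g (c \<odot> h)" if "c \<in> carrier (L0 M)" for c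
    using that g h by (simp add: rank_one_apply D_closed ip_smult)
  then have "rank_one f g ` D = module_span (L0 M) X {f}"
    unfolding span using g h(1) by (auto simp: rank_one_apply D_closed ip_D_closed)
  moreover have "rank_one f g \<in> linear_ops (L0 M) X D \<and> rank_one f g ` D \<subseteq> D"
    using rank_one_Lplus[OF f g] by (simp add: Lplus_def)
  ultimately show ?thesis
    using rank_one_Lplus[OF f g] f D_carrier unfolding Fplus_def finite_rank_ops_def
    by (intro IntI CollectI conjI exI[of _ "{f}"]) simp_all
qed

section \<open>Derivations are inner\<close>

text \<open>For \<open>x\<close> implementing \<open>\<delta>\<close>, the formula \<open>x \<phi> = \<delta> (\<phi> \<otimes> e) e\<close> determines the representative with
  \<open>x e = \<delta> (e \<otimes> e) e\<close>, that is, with \<open>e \<otimes> e\<close> annihilating \<open>x e\<close>.\<close>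

definition implementing_op :: "(('x \<Rightarrow> 'x) \<Rightarrow> 'x \<Rightarrow> 'x) \<Rightarrow> 'x \<Rightarrow> 'x \<Rightarrow> 'x"
  where "implementing_op \<delta> e = (\<lambda>\<phi>\<in>D. \<delta> (rank_one \<phi> e) e)"

context
  fixes U \<delta> e
  assumes U: "subalgebra U (L0 M) A" and FU: "Fplus (L0 M) X ip D \<subseteq> U"
    and \<delta>: "linear_derivation (L0 M) A U \<delta>"
    and e: "e \<in> D" "ip e e = \<one>\<^bsub>L0 M\<^esub>"
begin

abbreviation "x \<equiv> implementing_op \<delta> e"

lemma x_apply: "\<phi> \<in> D \<Longrightarrow> x \<phi> = \<delta> (rank_one \<phi> e) e"
  by (simp add: implementing_op_def)

lemma U_Lplus: "a \<in> U \<Longrightarrow> a \<in> carrier A"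
  using U by (auto simp: subalgebra_def submodule_def dest: subgroup.mem_carrier)

lemma \<delta>_Lplus: "a \<in> U \<Longrightarrow> \<delta> a \<in> carrier A"
  using \<delta> by (auto simp: linear_derivation_def)

lemma rank_one_e_mem_U: "\<phi> \<in> D \<Longrightarrow> rank_one \<phi> e \<in> U"
  using rank_one_Fplus[of \<phi> e e] e FU by blast

lemma x_maps: "\<phi> \<in> D \<Longrightarrow> x \<phi> \<in> D"
  using e by (simp add: x_apply Lplus_maps \<delta>_Lplus rank_one_e_mem_U)

lemma x_add:
  assumes "\<phi> \<in> D" "\<psi> \<in> D"
  shows "x (\<phi> \<oplus> \<psi>) = x \<phi> \<oplus> x \<psi>"
proof -
  have "rank_one (\<phi> \<oplus> \<psi>) e = rank_one \<phi> e \<oplus>\<^bsub>A\<^esub> rank_one \<psi> e"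
    using assms e by (intro Lplus_eqI Lplus_add_closed rank_one_Lplus D_add)
      (auto simp: rank_one_apply Lplus_apply smult_r_distr D_closed ip_D_closed)
  moreover have "\<delta> (rank_one \<phi> e \<oplus>\<^bsub>A\<^esub> rank_one \<psi> e) = \<delta> (rank_one \<phi> e) \<oplus>\<^bsub>A\<^esub> \<delta> (rank_one \<psi> e)"
    using \<delta> assms rank_one_e_mem_U by (auto simp: linear_derivation_def)
  ultimately show ?thesis
    using assms e by (simp add: x_apply D_add Lplus_apply)
qed

lemma x_smult:
  assumes "c \<in> carrier (L0 M)" "\<phi> \<in> D"
  shows "x (c \<odot> \<phi>) = c \<odot> x \<phi>"
proof -
  have "rank_one (c \<odot> \<phi>) e = c \<odot>\<^bsub>A\<^esub> rank_one \<phi> e"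
    using assms e by (intro Lplus_eqI Lplus_smult_closed rank_one_Lplus D_smult)
      (auto simp: rank_one_apply Lplus_apply smult_assoc1[symmetric] D_closed ip_D_closed R.m_comm)
  moreover have "\<delta> (c \<odot>\<^bsub>A\<^esub> rank_one \<phi> e) = c \<odot>\<^bsub>A\<^esub> \<delta> (rank_one \<phi> e)"
    using \<delta> assms rank_one_e_mem_U by (auto simp: linear_derivation_def)
  ultimately show ?thesis
    using assms e by (simp add: x_apply D_smult Lplus_apply)
qed

text \<open>The Leibniz rule for \<open>a (\<phi> \<otimes> e) = (a \<phi>) \<otimes> e\<close>, evaluated at \<open>e\<close>.\<close>

lemma x_comp:
  assumes a: "a \<in> U" and \<phi>: "\<phi> \<in> D"
  shows "x (a \<phi>) = \<delta> a \<phi> \<oplus> a (x \<phi>)"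
proof -
  note aL = U_Lplus[OF a]
  have "a \<otimes>\<^bsub>A\<^esub> rank_one \<phi> e = rank_one (a \<phi>) e"
    using \<phi> e aL by (intro Lplus_eqI Lplus_mult_closed rank_one_Lplus)
      (auto simp: rank_one_apply Lplus_apply Lplus_maps Lplus_smult_arg ip_D_closed)
  moreover have "\<delta> (a \<otimes>\<^bsub>A\<^esub> rank_one \<phi> e) =
      \<delta> a \<otimes>\<^bsub>A\<^esub> rank_one \<phi> e \<oplus>\<^bsub>A\<^esub> a \<otimes>\<^bsub>A\<^esub> \<delta> (rank_one \<phi> e)"
    using \<delta> a rank_one_e_mem_U[OF \<phi>] by (auto simp: linear_derivation_def)
  ultimately have "x (a \<phi>) = \<delta> a (rank_one \<phi> e e) \<oplus> a (\<delta> (rank_one \<phi> e) e)"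
    using \<phi> e aL by (simp add: x_apply Lplus_maps Lplus_apply)
  then show ?thesis
    using \<phi> e by (simp add: rank_one_apply x_apply D_carrier)
qed

text \<open>The normalization puts \<open>e \<otimes> \<psi>\<close> into \<open>U\<close>, and pairing \<open>x (e \<otimes> \<psi>) = \<delta> (e \<otimes> \<psi>) + (e \<otimes> \<psi>) x\<close> with \<open>e\<close> isolates
  \<open>\<langle>x \<phi>, \<psi>\<rangle>\<close>.\<close>

lemma x_formal_adjoint_normalized:
  assumes \<psi>: "\<psi> \<in> D" and norm: "ip \<psi> e = \<one>\<^bsub>L0 M\<^esub>"
  shows "\<exists>\<eta>\<in>D. \<forall>\<phi>\<in>D. ip (x \<phi>) \<psi> = ip \<phi> \<eta>"
proof -
  have "ip e \<psi> = \<one>\<^bsub>L0 M\<^esub>"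
    using ip_cnj[of e \<psi>] norm e \<psi> by (simp add: D_carrier L0_cnj_one)
  then have b: "rank_one e \<psi> \<in> U"
    using rank_one_Fplus[of e \<psi> e] e \<psi> FU by blast
  obtain \<zeta> where \<zeta>: "\<zeta> \<in> D" "\<And>\<phi>. \<phi> \<in> D \<Longrightarrow> ip (\<delta> (rank_one e \<psi>) \<phi>) e = ip \<phi> \<zeta>"
    using Lplus_formal_adjoint[OF \<delta>_Lplus[OF b] e(1)] by blast
  define c where "c = ip (x e) e"
  have c: "c \<in> carrier (L0 M)" unfolding c_def by (simp add: ip_D_closed x_maps e)
  let ?\<eta> = "L0_cnj M c \<odot> \<psi> \<oplus> \<ominus> \<zeta>"
  have "ip (x \<phi>) \<psi> = ip \<phi> ?\<eta>" if \<phi>: "\<phi> \<in> D" for \<phi>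
  proof -
    have "ip (x (rank_one e \<psi> \<phi>)) e = ip (\<delta> (rank_one e \<psi>) \<phi> \<oplus> rank_one e \<psi> (x \<phi>)) e"
      using x_comp[OF b \<phi>] by simp
    then have "ip \<phi> \<psi> \<otimes>\<^bsub>L0 M\<^esub> c = ip \<phi> \<zeta> \<oplus>\<^bsub>L0 M\<^esub> ip (x \<phi>) \<psi>"
      using \<phi> \<psi> e \<zeta> \<delta>_Lplus[OF b]
      by (simp add: rank_one_apply x_smult x_maps ip_D_closed ip_smult ip_add D_closed
          Lplus_maps c_def)
    then have "ip (x \<phi>) \<psi> = ip \<phi> \<psi> \<otimes>\<^bsub>L0 M\<^esub> c \<oplus>\<^bsub>L0 M\<^esub> \<ominus>\<^bsub>L0 M\<^esub> ip \<phi> \<zeta>"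
      using \<phi> \<psi> \<zeta>(1) c by (simp add: ip_D_closed x_maps R.add.m_ac R.r_neg2 R.r_neg)
    then show ?thesis
      using \<phi> \<psi> \<zeta>(1) c
      by (simp add: ip_add_right ip_smult_right ip_minus_right D_closed L0_cnj_closed
          L0_cnj_cnj R.m_comm ip_D_closed)
  qed
  then show ?thesis
    using c \<psi> \<zeta>(1) by (intro bexI[of _ ?\<eta>]) (auto simp: D_closed L0_cnj_closed)
qed

text \<open>The vectors with a formal adjoint value form a submodule, and \<open>\<psi>\<close> is a combination of \<open>e\<close> and a
  vector \<open>\<psi> + c e\<close>, where \<open>c\<close> is chosen so that the latter is normalized.\<close>

lemma implementing_op_formal_adjoint:
  assumes \<psi>: "\<psi> \<in> D"
  shows "\<exists>\<eta>\<in>D. \<forall>\<phi>\<in>D. ip (x \<phi>) \<psi> = ip \<phi> \<eta>"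
proof -
  define c where "c = \<one>\<^bsub>L0 M\<^esub> \<ominus>\<^bsub>L0 M\<^esub> ip \<psi> e"
  define \<psi>' where "\<psi>' = \<psi> \<oplus> c \<odot> e"
  have c: "c \<in> carrier (L0 M)" using e \<psi> by (simp add: c_def ip_D_closed)
  have \<psi>': "\<psi>' \<in> D" using e \<psi> c by (simp add: \<psi>'_def D_closed)
  have "ip \<psi>' e = \<one>\<^bsub>L0 M\<^esub>"
    using e \<psi> c by (simp add: \<psi>'_def ip_add ip_smult D_closed ip_D_closed)
      (simp add: c_def R.minus_eq ip_D_closed R.add.m_ac R.r_neg2 R.r_neg)
  then obtain \<eta>' where \<eta>': "\<eta>' \<in> D" "\<And>\<phi>. \<phi> \<in> D \<Longrightarrow> ip (x \<phi>) \<psi>' = ip \<phi> \<eta>'"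
    using x_formal_adjoint_normalized[OF \<psi>'] by blast
  obtain \<zeta> where \<zeta>: "\<zeta> \<in> D" "\<And>\<phi>. \<phi> \<in> D \<Longrightarrow> ip (x \<phi>) e = ip \<phi> \<zeta>"
    using x_formal_adjoint_normalized[OF e] by blast
  have "\<psi> = \<psi>' \<oplus> \<ominus> (c \<odot> e)"
    using e \<psi> c by (simp add: \<psi>'_def D_carrier M.a_assoc M.r_neg)
  then have "ip (x \<phi>) \<psi> = ip \<phi> (\<eta>' \<oplus> \<ominus> (c \<odot> \<zeta>))" if "\<phi> \<in> D" for \<phi>
    using that e c \<psi>' \<eta>' \<zeta>
    by (simp add: ip_add_right ip_minus_right ip_smult_right D_closed x_maps)
  then show ?thesis
    using c \<eta>'(1) \<zeta>(1) by (intro bexI[of _ "\<eta>' \<oplus> \<ominus> (c \<odot> \<zeta>)"]) (auto simp: D_closed)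
qed

lemma implementing_op_Lplus: "x \<in> carrier A"
  by (rule LplusI)
    (auto simp: x_maps x_add x_smult implementing_op_formal_adjoint, simp add: implementing_op_def)

lemma derivation_eq_commutator:
  assumes a: "a \<in> U"
  shows "\<delta> a = x \<otimes>\<^bsub>A\<^esub> a \<ominus>\<^bsub>A\<^esub> a \<otimes>\<^bsub>A\<^esub> x"
proof -
  interpret Lp: abelian_group A by (rule Lplus_abelian_group)
  note closed = \<delta>_Lplus[OF a] Lplus_mult_closed[OF U_Lplus[OF a] implementing_op_Lplus]
    Lplus_mult_closed[OF implementing_op_Lplus U_Lplus[OF a]]
  have "x \<otimes>\<^bsub>A\<^esub> a = \<delta> a \<oplus>\<^bsub>A\<^esub> a \<otimes>\<^bsub>A\<^esub> x"
    using closed by (intro Lplus_eqI Lp.a_closed) (auto simp: Lplus_apply x_comp[OF a])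
  then show ?thesis
    using closed by (simp add: Lp.minus_eq Lp.a_assoc Lp.r_neg)
qed

end

lemma derivation_inner:
  assumes "subalgebra U (L0 M) A" "Fplus (L0 M) X ip D \<subseteq> U" "linear_derivation (L0 M) A U \<delta>"
    and "e \<in> D" "kh_norm M ip e = \<one>\<^bsub>L0 M\<^esub>"
  shows "\<exists>x\<in>carrier A. \<forall>a\<in>U. \<delta> a = x \<otimes>\<^bsub>A\<^esub> a \<ominus>\<^bsub>A\<^esub> a \<otimes>\<^bsub>A\<^esub> x"
proof -
  have "ip e e = \<one>\<^bsub>L0 M\<^esub>" using assms(4,5) by (intro ip_self_eq_one D_carrier)
  then show ?thesis
    by (intro bexI[of _ "implementing_op \<delta> e"] ballI
      implementing_op_Lplus[OF assms(1-4)] derivation_eq_commutator[OF assms(1-4)])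
qed

end

theorem corollary1:
  fixes M :: "'w measure"
    and X :: "(('w \<Rightarrow> complex) set, 'x) module"
    and ip :: "'x \<Rightarrow> 'x \<Rightarrow> ('w \<Rightarrow> complex) set"
    and D :: "'x set"
  assumes "finite_measure M" and "complete_measure M"
    and "kaplansky_hilbert_module M X ip"
    and "submodule D (L0 M) X" and "bo_dense M X ip D"
    and "\<exists>e\<in>D. kh_norm M ip e = \<one>\<^bsub>L0 M\<^esub>"
  defines "A \<equiv> Lplus (L0 M) X ip D"
  shows "(\<forall>U \<delta>. subalgebra U (L0 M) A \<and> Fplus (L0 M) X ip D \<subseteq> U \<and>
            linear_derivation (L0 M) A U \<delta> \<longrightarrow>
          (\<exists>x\<in>carrier A. \<forall>a\<in>U. \<delta> a = x \<otimes>\<^bsub>A\<^esub> a \<ominus>\<^bsub>A\<^esub> a \<otimes>\<^bsub>A\<^esub> x))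
       \<and> (\<forall>\<delta>. linear_derivation (L0 M) A (carrier A) \<delta> \<longrightarrow>
          (\<exists>x\<in>carrier A. \<forall>a\<in>carrier A. \<delta> a = x \<otimes>\<^bsub>A\<^esub> a \<ominus>\<^bsub>A\<^esub> a \<otimes>\<^bsub>A\<^esub> x))"
proof -
  interpret dense_domain M X ip D
    by (rule dense_domain.intro[OF assms(3) dense_domain_axioms.intro[OF assms(4,5)]])
  obtain e where e: "e \<in> D" "kh_norm M ip e = \<one>\<^bsub>L0 M\<^esub>" using assms(6) by blast
  have "Fplus (L0 M) X ip D \<subseteq> carrier (Lplus (L0 M) X ip D)"
    by (simp add: Fplus_def)
  then show ?thesis
    unfolding A_def using derivation_inner[OF _ _ _ e] subalgebra_carrier_Lplus by blast
qed

end
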